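(* Let $(X,d)$ be a complete metric space and let $T:X\to P_{cl}(X)$ be such that $SFix(T)\neq\emptyset$ and there exist $\alpha,\beta,\gamma\ge 0$ with $\alpha+\beta+\gamma<1$ such that $$H(T(x),T(y))\le \alpha\, d(x,y)+\beta\, D(x,T(y))+\gamma\, D(y,T(x))\quad\text{for all } x,y\in X.$$ Then the strict fixed point problem $T(x)=\{x\}$ has the data dependence property.
   Context: For a metric space $(X,d)$, $P(X)$ is the family of all nonempty subsets of $X$ and $P_{cl}(X)$ the family of all nonempty closed subsets. For $T:X\to P(X)$, $SFix(T)=\{x\in X: T(x)=\{x\}\}$. For $A,B\in P(X)$: $D(A,B)=\inf\{d(a,b):a\in A,b\in B\}$, with $D(x,B):=D(\{x\},B)$; $e(A,B)=\sup\{D(a,B):a\in A\}\in[0,+\infty]$; $H(A,B)=\max\{e(A,B),e(B,A)\}\in[0,+\infty]$. The strict fixed point problem $T(x)=\{x\}$ has the data dependence property if there is a constant $c>0$ (not depending on $F$ or $\eta$) such that, for each $\eta>0$ and each multivalued operator $F:X\to P(X)$ with $SFix(F)\neq\emptyset$ and $H(T(x),F(x))\le\eta$ for all $x\in X$, and for each strict fixed point $x^*$ of $T$, there exists a strict fixed point $u^*\in X$ of $F$ with $d(x^*,u^* )\le c\,\eta$. *)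

theory Defs
  imports "HOL-Analysis.Analysis"
begin

text \<open>
  The gap D(A,B) is \<open>setdist A B\<close>, with D(x,B) rendered as \<open>setdist {x} B\<close>. Since
  \<open>setdist\<close> is 0 by convention when an argument is empty, the notions below agree with the
  usual ones only for nonempty sets.
\<close>

definition excess :: "'a::metric_space set \<Rightarrow> 'a set \<Rightarrow> ennreal" where
  "excess A B = (SUP a\<in>A. ennreal (setdist {a} B))"

definition hausdorff :: "'a::metric_space set \<Rightarrow> 'a set \<Rightarrow> ennreal" where
  "hausdorff A B = max (excess A B) (excess B A)"

definition SFix :: "('a \<Rightarrow> 'a set) \<Rightarrow> 'a set" where
  "SFix T = {x. T x = {x}}"

definition strict_fixed_point_data_dependence :: "('a::metric_space \<Rightarrow> 'a set) \<Rightarrow> bool" where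
  "strict_fixed_point_data_dependence T \<longleftrightarrow>
    (\<exists>c::real. c > 0 \<and>
      (\<forall>\<eta>::real. \<forall>F::'a \<Rightarrow> 'a set.
        \<eta> > 0 \<longrightarrow> (\<forall>x. F x \<noteq> {}) \<longrightarrow> SFix F \<noteq> {} \<longrightarrow>
        (\<forall>x. hausdorff (T x) (F x) \<le> ennreal \<eta>) \<longrightarrow>
        (\<forall>x\<in>SFix T. \<exists>u\<in>SFix F. dist x u \<le> c * \<eta>)))"

end

theory Submission
  imports Defs
begin

text \<open>
  Every strict fixed point \<open>u\<close> of \<open>F\<close> lies close to every strict fixed point \<open>x\<close> of \<open>T\<close>, so the
  point required by data dependence need not be constructed. Since \<open>F u = {u}\<close>, all of \<open>T u\<close> lies
  within \<open>\<eta>\<close> of \<open>u\<close>; take any \<open>t \<in> T u\<close>. Since \<open>T x = {x}\<close>, the contraction condition at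
  \<open>(u, x)\<close> bounds
  \[ d(t,x) \le \alpha\, d(u,x) + \beta\, d(u,x) + \gamma\, D(x, T u)
       \le (\alpha + \beta + \gamma)\, d(u,x) + \gamma \eta, \]
  because \<open>D(x, T u) \<le> d(x,t) \<le> d(x,u) + \<eta>\<close>. Adding \<open>d(u,t) \<le> \<eta>\<close> and solving for \<open>d(u,x)\<close>,
  which is possible as \<open>\<alpha> + \<beta> + \<gamma> < 1\<close>, gives \<open>d(x,u) \<le> c \<eta>\<close> with
  \<open>c = (1 + \<gamma>) / (1 - \<alpha> - \<beta> - \<gamma>)\<close>.
\<close>

text \<open>
  Against a singleton the gap is attained at its only point, so a bound on the Hausdorff
  distance controls every single point of the other set.
\<close>
lemma dist_le_if_hausdorff_singleton_le:
  assumes "hausdorff A {b} \<le> ennreal r" and "0 \<le> r" and "a \<in> A"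
  shows "dist a b \<le> r"
proof -
  have "ennreal (dist a b) \<le> excess A {b}"
    unfolding excess_def using SUP_upper[OF \<open>a \<in> A\<close>, of "\<lambda>a. ennreal (setdist {a} {b})"]
    by simp
  also have "\<dots> \<le> ennreal r"
    using assms(1) by (simp add: hausdorff_def)
  finally show ?thesis
    using \<open>0 \<le> r\<close> by simp
qed

theorem theorem2p8:
  fixes T :: "'a::complete_space \<Rightarrow> 'a set" and \<alpha> \<beta> \<gamma> :: real
  assumes "\<And>x. T x \<noteq> {}" and "\<And>x. closed (T x)"
    and "SFix T \<noteq> {}"
    and "\<alpha> \<ge> 0" and "\<beta> \<ge> 0" and "\<gamma> \<ge> 0" and "\<alpha> + \<beta> + \<gamma> < 1"
    and "\<And>x y. hausdorff (T x) (T y) \<le>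
      ennreal (\<alpha> * dist x y + \<beta> * setdist {x} (T y) + \<gamma> * setdist {y} (T x))"
  shows "strict_fixed_point_data_dependence T"
proof -
  define c where "c = (1 + \<gamma>) / (1 - (\<alpha> + \<beta> + \<gamma>))"
  have "c > 0"
    using assms(6,7) by (simp add: c_def)
  moreover have "\<exists>u\<in>SFix F. dist x u \<le> c * \<eta>"
    if "\<eta> > 0" and "SFix F \<noteq> {}" and close: "\<And>x. hausdorff (T x) (F x) \<le> ennreal \<eta>"
      and "x \<in> SFix T" for \<eta> F x
  proof -
    have Tx: "T x = {x}"
      using \<open>x \<in> SFix T\<close> by (simp add: SFix_def)
    obtain u where u: "u \<in> SFix F"
      using \<open>SFix F \<noteq> {}\<close> by blast
    then have Fu: "F u = {u}"
      by (simp add: SFix_def)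
    obtain t where t: "t \<in> T u"
      using assms(1) by blast
    have tu: "dist t u \<le> \<eta>"
      using dist_le_if_hausdorff_singleton_le[of "T u" u \<eta> t] close[of u] Fu t \<open>\<eta> > 0\<close> by simp
    have tx: "dist t x \<le> \<alpha> * dist u x + \<beta> * dist u x + \<gamma> * setdist {x} (T u)"
      using dist_le_if_hausdorff_singleton_le[OF _ _ t, of x] assms(8)[of u x] assms(4-6) Tx
      by (simp add: setdist_pos_le)
    have "setdist {x} (T u) \<le> dist x t"
      using t by (simp add: setdist_le_dist)
    also have "\<dots> \<le> dist u x + \<eta>"
      using dist_triangle[of x t u] tu by (simp add: dist_commute)
    finally have "\<gamma> * setdist {x} (T u) \<le> \<gamma> * (dist u x + \<eta>)"
      using assms(6) by (rule mult_left_mono)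
    moreover have "dist u x \<le> \<eta> + dist t x"
      using dist_triangle[of u x t] tu by (simp add: dist_commute)
    ultimately have "dist u x * (1 - (\<alpha> + \<beta> + \<gamma>)) \<le> (1 + \<gamma>) * \<eta>"
      using tx by (simp add: algebra_simps)
    then have "dist x u \<le> c * \<eta>"
      using assms(7) by (simp add: c_def pos_le_divide_eq dist_commute)
    then show ?thesis
      using u by blast
  qed
  ultimately show ?thesis
    unfolding strict_fixed_point_data_dependence_def by blast
qed

end
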